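(* Let $T$ be an operator (continuous linear self-map) on a separable $F$-space $X$. Suppose there are a dense subset $X_0$ of $X$ and a sequence of maps $S_n : X_0 \to X$, $n \ge 0$ (not assumed linear or continuous), such that, for each $x \in X_0$: (i) $\sum_{n=0}^\infty T^n x$ converges unconditionally; (ii) $\sum_{n=0}^\infty S_n x$ converges unconditionally; (iii) $T^n S_n x = x$ for all $n \ge 0$, and $T^m S_n x = S_{n-m} x$ whenever $n > m \ge 0$. Then there is a $T$-invariant strongly mixing Borel probability measure $\mu$ on $X$ with full support.
   Context: An $F$-space is a topological vector space over $\mathbb{K}$ ($\mathbb{K}=\mathbb{R}$ or $\mathbb{C}$) whose topology is induced by a complete translation-invariant metric. An operator on $X$ is a continuous linear map $T : X \to X$. A series $\sum_n x_n$ in $X$ converges unconditionally if it converges and, for any $0$-neighbourhood $U$ in $X$, there exists $N \in \mathbb{N}$ such that $\sum_{n\in F} x_n \in U$ for every finite set $F \subset \{N, N+1, N+2, \dots\}$. Let $\mathfrak{B}$ be the Borel $\sigma$-algebra of $X$ and $\mu$ a Borel probability measure on $X$. The measure $\mu$ has full support if $\mu(U) > 0$ for each non-empty open set $U \subset X$. It is $T$-invariant if $\mu(T^{-1}(A)) = \mu(A)$ for all $A \in \mathfrak{B}$. A $T$-invariant $\mu$ is called strongly mixing if $T$ is strongly mixing with respect to $\mu$, i.e. $\lim_{n\to\infty} \mu(A \cap T^{-n}(B)) = \mu(A)\mu(B)$ for all $A, B \in \mathfrak{B}$. *)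

theory Defs
  imports "HOL-Probability.Probability"
begin

text \<open>
  The scalar field is an arbitrary type of class \<^class>\<open>real_normed_field\<close>. The types \<^typ>\<open>real\<close> and
  \<^typ>\<open>complex\<close> are instances, and by the Gelfand--Mazur theorem they are the only ones up to
  isometric isomorphism. The class \<^class>\<open>topological_ab_group_add\<close> supplies the continuity of
  addition.
\<close>

locale topological_vector_space = vector_space scaleK
  for scaleK :: "'k::real_normed_field \<Rightarrow> 'a::topological_ab_group_add \<Rightarrow> 'a" +
  assumes continuous_scale: "continuous_on UNIV (\<lambda>(c, x). scaleK c x)"

locale F_space = topological_vector_space scaleK
  for scaleK :: "'k::real_normed_field \<Rightarrow> 'a::topological_ab_group_add \<Rightarrow> 'a" +
  assumes complete_invariant_metric:
    "\<exists>d. Metric_space UNIV d \<and> Metric_space.mtopology UNIV d = (euclidean :: 'a topology) \<and>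
         Metric_space.mcomplete UNIV d \<and> (\<forall>x y z. d (x + z) (y + z) = d x y)"

definition operator_on ::
    "('k::real_normed_field \<Rightarrow> 'a::topological_ab_group_add \<Rightarrow> 'a) \<Rightarrow> ('a \<Rightarrow> 'a) \<Rightarrow> bool" where
  "operator_on scaleK T \<longleftrightarrow> Vector_Spaces.linear scaleK scaleK T \<and> continuous_on UNIV T"

definition unconditionally_convergent ::
    "(nat \<Rightarrow> 'a::{topological_space, comm_monoid_add}) \<Rightarrow> bool" where
  "unconditionally_convergent x \<longleftrightarrow> summable x \<and>
     (\<forall>U. 0 \<in> interior U \<longrightarrow> (\<exists>N. \<forall>F. finite F \<and> F \<subseteq> {N..} \<longrightarrow> (\<Sum>n\<in>F. x n) \<in> U))"

definition borel_probability :: "'a::topological_space measure \<Rightarrow> bool" where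
  "borel_probability \<mu> \<longleftrightarrow> prob_space \<mu> \<and> sets \<mu> = sets borel"

definition full_support :: "'a::topological_space measure \<Rightarrow> bool" where
  "full_support \<mu> \<longleftrightarrow> (\<forall>U. open U \<and> U \<noteq> {} \<longrightarrow> measure \<mu> U > 0)"

definition invariant_measure :: "('a::topological_space \<Rightarrow> 'a) \<Rightarrow> 'a measure \<Rightarrow> bool" where
  "invariant_measure T \<mu> \<longleftrightarrow> (\<forall>A\<in>sets borel. measure \<mu> (T -` A) = measure \<mu> A)"

definition strongly_mixing :: "('a::topological_space \<Rightarrow> 'a) \<Rightarrow> 'a measure \<Rightarrow> bool" where
  "strongly_mixing T \<mu> \<longleftrightarrow>
     (\<forall>A\<in>sets borel. \<forall>B\<in>sets borel.
        (\<lambda>n. measure \<mu> (A \<inter> (T ^^ n) -` B)) \<longlonglongrightarrow> measure \<mu> A * measure \<mu> B)"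

end

theory Submission
  imports Defs
begin

text \<open>
  The measure is the law of a random series built from full orbits through points of \<open>X0\<close>.
  Choose a sequence \<open>x 1, x 2, \<dots>\<close> in \<open>X0\<close> that is dense in the space, and for \<open>m \<ge> 1\<close> let
  \<open>a k m\<close> be \<open>T\<^sup>k (x m)\<close> for \<open>k \<ge> 0\<close> and \<open>S\<^sub>-\<^sub>k (x m)\<close> for \<open>k < 0\<close>; put \<open>a k 0 = 0\<close>.
  By condition (iii), every \<open>k \<mapsto> a k m\<close> is a full orbit, \<open>T (a k m) = a (k + 1) m\<close>,
  and (i) and (ii) say that \<open>\<Sum>k. a k m\<close> converges unconditionally over the integers.

  Let \<open>\<omega> = (\<omega> k)\<close> be independent, identically distributed symbols from the natural numbers, indexed by
  the integers, and let \<open>\<Phi> \<omega> = \<Sum>k. a k (\<omega> k)\<close>. Applying \<open>T\<close> to \<open>\<Phi> \<omega>\<close> moves every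
  term one place to the right, so \<open>\<Phi> \<circ> shift = T \<circ> \<Phi>\<close> almost surely. Hence the law of \<open>\<Phi>\<close> is
  a factor of the two-sided Bernoulli shift, and invariance and strong mixing are inherited from it
  (\<open>bernoulli_shift_mixing\<close>).

  What must be arranged is that the series converges. Take an invariant complete metric and
  write \<open>magnitude x\<close> for the distance of \<open>x\<close> to \<open>0\<close>. Choose levels \<open>N m\<close> such that every finite
  subsum of \<open>\<Sum>k. a k m\<close> over places with \<open>\<bar>k\<bar> \<ge> N m\<close> has magnitude at most \<open>4\<^sup>-\<^sup>m\<close>. Grouping the terms
  of a finite sum \<open>\<Sum>k\<in>F. a k (\<omega> k)\<close> by their symbols shows that these sums become uniformly small
  as \<open>F\<close> moves to infinity, provided each symbol \<open>m\<close> occurs in \<open>F\<close> only at places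
  \<open>\<bar>k\<bar> \<ge> N m\<close> (\<open>mixed_series_tail\<close>). If the common law \<open>p\<close> of the symbols charges every number but
  satisfies \<open>\<Sum>k. p {m. k < N m} < \<infinity>\<close> (\<open>pmf_with_small_level_tails\<close>), then by Borel--Cantelli
  all but finitely many places of almost every \<open>\<omega>\<close> obey this restriction, and \<open>\<Phi>\<close> is defined
  almost everywhere.

  For full support, fix \<open>m\<close> with \<open>x m\<close> in the given open set and ask that \<open>\<omega> 0 = m\<close>, that \<open>\<omega> k = 0\<close> at the
  other places below a large bound, and that the restriction holds at all places beyond it. Then
  \<open>\<Phi> \<omega>\<close> is close to \<open>x m\<close>, and the event has positive probability because the product of the
  probabilities of its one-place constraints converges to a positive number
  (\<open>measure_bilateral_rectangle_pos\<close>). Everything takes place in the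
  additive group of the space, with its complete invariant metric.
\<close>

section \<open>Strong mixing of the Bernoulli shift\<close>

text \<open>
  Both passages from the generator to the whole \<open>\<sigma>\<close>-algebra (first in \<open>B\<close>, then in \<open>A\<close>) are
  Dynkin arguments. For a countable disjoint union the limit may be exchanged with the sum because
  the terms are dominated by \<open>measure P (D i)\<close>, uniformly in \<open>n\<close>.
\<close>

lemma mixing_from_generator:
  fixes \<tau> :: "nat \<Rightarrow> 'a \<Rightarrow> 'a"
  assumes "prob_space P"
    and meas: "\<And>n. \<tau> n \<in> P \<rightarrow>\<^sub>M P"
    and pres: "\<And>n. distr P P (\<tau> n) = P"
    and gen: "sets P = sigma_sets (space P) E" "Int_stable E" "E \<subseteq> Pow (space P)"
    and mix: "\<And>A B. A \<in> E \<Longrightarrow> B \<in> E \<Longrightarrow>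
      (\<lambda>n. measure P (A \<inter> (\<tau> n -` B \<inter> space P))) \<longlonglongrightarrow> measure P A * measure P B"
    and A: "A \<in> sets P" and B: "B \<in> sets P"
  shows "(\<lambda>n. measure P (A \<inter> (\<tau> n -` B \<inter> space P))) \<longlonglongrightarrow> measure P A * measure P B"
proof -
  interpret prob_space P by fact
  note [measurable] = meas
  have pre [measurable]: "\<tau> n -` B \<inter> space P \<in> sets P" if "B \<in> sets P" for n B
    using that measurable_sets[OF meas] by blast
  have pres': "measure P (\<tau> n -` B \<inter> space P) = measure P B" if "B \<in> sets P" for n B
    using measure_distr[OF meas that, of n] pres[of n] by simp
  have E_sets: "A \<in> sets P" if "A \<in> E" for A
    using that gen(1) by auto
  have dominated: "(\<lambda>n. \<Sum>i. f i n) \<longlonglongrightarrow> (\<Sum>i. g i)"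
    if "\<And>i. f i \<longlonglongrightarrow> g i" "\<And>i n. 0 \<le> f i n" "\<And>i n. f i n \<le> b i" "summable b"
    for f :: "nat \<Rightarrow> nat \<Rightarrow> real" and g b :: "nat \<Rightarrow> real"
    using tannerys_theorem[of f g sequentially b] that by (auto simp: case_prod_unfold)
  have step1: "(\<lambda>n. measure P (A \<inter> (\<tau> n -` B \<inter> space P))) \<longlonglongrightarrow> measure P A * measure P B"
    if A: "A \<in> E" and B: "B \<in> sets P" for A B
  proof -
    have [measurable]: "A \<in> sets P" using A by (rule E_sets)
    have "B \<in> sigma_sets (space P) E" using B gen(1) by simp
    from gen(2,3) this show ?thesis
    proof (induction rule: sigma_sets_induct_disjoint)
      case (basic B)
      then show ?case using mix A by blast
    next
      case empty
      then show ?case by simp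
    next
      case (compl B)
      then have [measurable]: "B \<in> sets P" using gen(1) by simp
      have "A \<inter> (\<tau> n -` (space P - B) \<inter> space P) = A - A \<inter> (\<tau> n -` B \<inter> space P)" for n
        using sets.sets_into_space[OF \<open>A \<in> sets P\<close>] measurable_space[OF meas] by auto
      then have "measure P (A \<inter> (\<tau> n -` (space P - B) \<inter> space P)) =
          measure P A - measure P (A \<inter> (\<tau> n -` B \<inter> space P))" for n
        by (simp add: finite_measure_Diff)
      moreover have "measure P A * measure P (space P - B) = measure P A - measure P A * measure P B"
        by (simp add: prob_compl algebra_simps)
      ultimately show ?case
        using tendsto_diff[OF tendsto_const compl.IH] by simp
    next
      case (union D)
      then have D [measurable]: "D i \<in> sets P" for i using gen(1) by auto
      have dis: "disjoint_family (\<lambda>i. A \<inter> (\<tau> n -` D i \<inter> space P))" for n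
        using union.hyps(1) by (fastforce simp: disjoint_family_on_def)
      have 1: "measure P (A \<inter> (\<tau> n -` (\<Union>i. D i) \<inter> space P)) =
          (\<Sum>i. measure P (A \<inter> (\<tau> n -` D i \<inter> space P)))" for n
      proof -
        have "A \<inter> (\<tau> n -` (\<Union>i. D i) \<inter> space P) = (\<Union>i. A \<inter> (\<tau> n -` D i \<inter> space P))" by auto
        then show ?thesis
          using sums_unique[OF finite_measure_UNION[OF _ dis]] by (simp add: image_subset_iff)
      qed
      have sums: "summable (\<lambda>i. measure P (D i))"
        using sums_summable[OF finite_measure_UNION[of D]] union.hyps(1) D by (simp add: image_subset_iff)
      have 2: "measure P A * measure P (\<Union>i. D i) = (\<Sum>i. measure P A * measure P (D i))"
        using sums_unique[OF finite_measure_UNION[of D]] union.hyps(1) D suminf_mult[OF sums]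
        by (simp add: image_subset_iff)
      have 3: "measure P (A \<inter> (\<tau> n -` D i \<inter> space P)) \<le> measure P (D i)" for i n
        using finite_measure_mono[OF Int_lower2 pre[OF D]] unfolding pres'[OF D] .
      show ?case
        unfolding 1 2 by (rule dominated[OF union.IH _ 3 sums]) simp
    qed
  qed
  have "A \<in> sigma_sets (space P) E" using A gen(1) by simp
  from gen(2,3) this show ?thesis
  proof (induction rule: sigma_sets_induct_disjoint)
    case (basic A)
    then show ?case using step1 B by blast
  next
    case empty
    then show ?case by simp
  next
    case (compl A)
    then have [measurable]: "A \<in> sets P" using gen(1) by simp
    have 1: "measure P ((space P - A) \<inter> (\<tau> n -` B \<inter> space P)) =
        measure P B - measure P (A \<inter> (\<tau> n -` B \<inter> space P))" for n
    proof -
      have "(space P - A) \<inter> (\<tau> n -` B \<inter> space P) =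
          (\<tau> n -` B \<inter> space P) - A \<inter> (\<tau> n -` B \<inter> space P)"
        by auto
      then show ?thesis
        using finite_measure_Diff[OF pre[OF B] sets.Int[OF \<open>A \<in> sets P\<close> pre[OF B]] Int_lower2]
        unfolding pres'[OF B] by (simp only:)
    qed
    have 2: "measure P (space P - A) * measure P B = measure P B - measure P A * measure P B"
      by (simp add: prob_compl algebra_simps)
    show ?case
      unfolding 1 2 by (intro tendsto_diff tendsto_const compl.IH)
  next
    case (union D)
    then have D [measurable]: "D i \<in> sets P" for i using gen(1) by auto
    have dis: "disjoint_family (\<lambda>i. D i \<inter> (\<tau> n -` B \<inter> space P))" for n
      using union.hyps(1) by (fastforce simp: disjoint_family_on_def)
    have 1: "measure P ((\<Union>i. D i) \<inter> (\<tau> n -` B \<inter> space P)) =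
        (\<Sum>i. measure P (D i \<inter> (\<tau> n -` B \<inter> space P)))" for n
      using sums_unique[OF finite_measure_UNION[OF _ dis, of n]] B by (simp add: image_subset_iff)
    have sums: "summable (\<lambda>i. measure P (D i))"
      using sums_summable[OF finite_measure_UNION[of D]] union.hyps(1) D by (simp add: image_subset_iff)
    have 2: "measure P (\<Union>i. D i) * measure P B = (\<Sum>i. measure P (D i) * measure P B)"
      using sums_unique[OF finite_measure_UNION[of D]] union.hyps(1) D suminf_mult2[OF sums]
      by (simp add: image_subset_iff)
    have 3: "measure P (D i \<inter> (\<tau> n -` B \<inter> space P)) \<le> measure P (D i)" for i n
      by (rule finite_measure_mono[OF Int_lower1 D])
    show ?case
      unfolding 1 2 by (rule dominated[OF union.IH _ 3 sums]) simp
  qed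
qed

lemma measure_cylinder:
  fixes M :: "'a measure"
  assumes M: "prob_space M" and J: "finite J" "\<And>k. k \<in> J \<Longrightarrow> X k \<in> sets M"
  shows "measure (PiM UNIV (\<lambda>_::'i. M)) {\<omega> \<in> space (PiM UNIV (\<lambda>_. M)). \<forall>k\<in>J. \<omega> k \<in> X k} =
    (\<Prod>k\<in>J. measure M (X k))"
proof -
  interpret product_prob_space "\<lambda>_::'i. M" UNIV
    using M by (simp add: product_prob_space_def product_prob_space_axioms_def product_sigma_finite_def
        prob_space_imp_sigma_finite)
  show ?thesis
    using emeasure_PiM_Collect[of J X] J
    by (simp add: P.emeasure_eq_measure M.emeasure_eq_measure prod_ennreal prod_nonneg)
qed

text \<open>
  The \<open>n\<close>-th power of the two-sided shift. It moves symbols to the right, the direction in which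
  \<open>T\<close> moves the places of an orbit.
\<close>

definition bilateral_shift :: "nat \<Rightarrow> (int \<Rightarrow> 'a) \<Rightarrow> int \<Rightarrow> 'a" where
  "bilateral_shift n \<omega> = (\<lambda>k. \<omega> (k - int n))"

lemma measurable_bilateral_shift: "bilateral_shift n \<in> PiM UNIV (\<lambda>_. M) \<rightarrow>\<^sub>M PiM UNIV (\<lambda>_. M)"
  unfolding bilateral_shift_def
  by (rule measurable_PiM_single') (auto intro!: measurable_component_singleton simp: space_PiM)

lemma distr_bilateral_shift:
  assumes "prob_space M"
  shows "distr (PiM UNIV (\<lambda>_. M)) (PiM UNIV (\<lambda>_. M)) (bilateral_shift n) = PiM UNIV (\<lambda>_. M)"
  using distr_PiM_reindex[of UNIV "\<lambda>_. M" "\<lambda>k. k - int n" UNIV] assms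
  by (simp add: inj_on_def bilateral_shift_def[abs_def] restrict_def)

text \<open>
  Once \<open>n\<close> exceeds the spread of the coordinates involved, two finite-dimensional cylinders become
  independent, so that the mixing identity is even exact for large \<open>n\<close>.
\<close>

lemma bernoulli_shift_mixing:
  fixes M :: "'a measure"
  assumes M: "prob_space M"
  defines "P \<equiv> PiM (UNIV :: int set) (\<lambda>_. M)"
  assumes A: "A \<in> sets P" and B: "B \<in> sets P"
  shows "(\<lambda>n. measure P (A \<inter> (bilateral_shift n -` B \<inter> space P))) \<longlonglongrightarrow> measure P A * measure P B"
proof (rule mixing_from_generator[where E = "prod_algebra UNIV (\<lambda>_. M)"])
  show "prob_space P"
    unfolding P_def by (rule prob_space_PiM) (rule M)
  show "bilateral_shift n \<in> P \<rightarrow>\<^sub>M P" "distr P P (bilateral_shift n) = P" for n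
    unfolding P_def by (rule measurable_bilateral_shift, rule distr_bilateral_shift[OF M])
  show "sets P = sigma_sets (space P) (prod_algebra UNIV (\<lambda>_. M))"
    unfolding P_def sets_PiM space_PiM ..
  show "Int_stable (prod_algebra UNIV (\<lambda>_. M))" by (rule Int_stable_prod_algebra)
  show "prod_algebra UNIV (\<lambda>_. M) \<subseteq> Pow (space P)"
    unfolding P_def space_PiM by (rule prod_algebra_sets_into_space)
  show "A \<in> sets P" "B \<in> sets P" by fact+
  note cyl = measure_cylinder[OF M, where 'i = int, folded P_def]
  fix A B assume "A \<in> prod_algebra (UNIV :: int set) (\<lambda>_. M)" "B \<in> prod_algebra (UNIV :: int set) (\<lambda>_. M)"
  then obtain I X J Y where
    A: "A = prod_emb UNIV (\<lambda>_. M) I (Pi\<^sub>E I X)" "finite I" "\<And>k. k \<in> I \<Longrightarrow> X k \<in> sets M" and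
    B: "B = prod_emb UNIV (\<lambda>_. M) J (Pi\<^sub>E J Y)" "finite J" "\<And>k. k \<in> J \<Longrightarrow> Y k \<in> sets M"
    by (elim prod_algebraE) blast
  have A': "A = {\<omega> \<in> space P. \<forall>k\<in>I. \<omega> k \<in> X k}" and B': "B = {\<omega> \<in> space P. \<forall>k\<in>J. \<omega> k \<in> Y k}"
    unfolding A(1) B(1) prod_emb_def P_def by (auto simp: space_PiM)
  obtain c where c: "\<And>k. k \<in> I \<union> J \<Longrightarrow> \<bar>k\<bar> \<le> c"
    using that[of "Max (abs ` (I \<union> J))"] A(2) B(2) by simp
  have "measure P (A \<inter> (bilateral_shift n -` B \<inter> space P)) = measure P A * measure P B"
    if n: "n > nat (2 * c)" for n
  proof -
    let ?J = "(\<lambda>k. k - int n) ` J" and ?Z = "\<lambda>k. if k \<in> I then X k else Y (k + int n)"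
    have dis: "I \<inter> ?J = {}"
    proof -
      have "i \<noteq> j - int n" if "i \<in> I" "j \<in> J" for i j
        using c[of i] c[of j] that n by auto
      then show ?thesis by auto
    qed
    have inj: "inj_on (\<lambda>k. k - int n) J" by (simp add: inj_on_def)
    have sh: "bilateral_shift n \<omega> \<in> space P" if "\<omega> \<in> space P" for \<omega>
      using that by (auto simp: bilateral_shift_def P_def space_PiM)
    have "j - int n \<notin> I" if "j \<in> J" for j
      using dis that by blast
    then have "(\<forall>k\<in>I \<union> ?J. \<omega> k \<in> ?Z k) \<longleftrightarrow>
        (\<forall>k\<in>I. \<omega> k \<in> X k) \<and> (\<forall>k\<in>J. bilateral_shift n \<omega> k \<in> Y k)" for \<omega>
      by (simp add: ball_Un bilateral_shift_def)
    then have "A \<inter> (bilateral_shift n -` B \<inter> space P) = {\<omega> \<in> space P. \<forall>k\<in>I \<union> ?J. \<omega> k \<in> ?Z k}"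
      unfolding A' B' using sh by auto
    then have "measure P (A \<inter> (bilateral_shift n -` B \<inter> space P)) = (\<Prod>k\<in>I \<union> ?J. measure M (?Z k))"
      using A(2,3) B(2,3) by (simp only:, intro cyl) auto
    also have "\<dots> = (\<Prod>k\<in>I. measure M (?Z k)) * (\<Prod>k\<in>?J. measure M (?Z k))"
      using A(2) B(2) dis by (intro prod.union_disjoint) auto
    also have "(\<Prod>k\<in>?J. measure M (?Z k)) = (\<Prod>k\<in>J. measure M (Y k))"
      using dis by (subst prod.reindex[OF inj], intro prod.cong) auto
    also have "(\<Prod>k\<in>I. measure M (?Z k)) = (\<Prod>k\<in>I. measure M (X k))"
      by simp
    finally show ?thesis
      unfolding A' B' using cyl[of I X] cyl[of J Y] A B by simp
  qed
  then show "(\<lambda>n. measure P (A \<inter> (bilateral_shift n -` B \<inter> space P))) \<longlonglongrightarrow> measure P A * measure P B"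
    by (intro tendsto_eventually eventually_at_top_dense[THEN iffD2]) blast
qed

section \<open>Product probability spaces over the integers\<close>

text \<open>
  An infinite product event has positive probability if all its factors do and their defects from
  one are summable. Beyond a place \<open>J\<close> the defects add up to less than \<open>1/2\<close>, hence every finite
  product over places beyond \<open>J\<close> is at least \<open>1/2\<close>.
\<close>

lemma measure_bilateral_rectangle_pos:
  fixes X :: "int \<Rightarrow> 'a set"
  assumes M: "prob_space M" and X: "\<And>k. X k \<in> sets M"
    and pos: "\<And>k. measure M (X k) > 0"
    and summable: "summable (\<lambda>j::nat. 1 - measure M (X (int j)))"
      "summable (\<lambda>j::nat. 1 - measure M (X (- int j)))"
  shows "measure (PiM UNIV (\<lambda>_. M)) {\<omega> \<in> space (PiM UNIV (\<lambda>_. M)). \<forall>k. \<omega> k \<in> X k} > 0"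
proof -
  define P where "P = PiM (UNIV :: int set) (\<lambda>_. M)"
  interpret M: prob_space M by fact
  interpret prob_space P unfolding P_def by (rule prob_space_PiM) (rule M)
  define u where "u k = 1 - measure M (X k)" for k
  have u: "0 \<le> u k" "u k \<le> 1" for k unfolding u_def by simp_all
  define b where "b j = u (int j) + u (- int j)" for j :: nat
  have b: "summable b" unfolding b_def u_def by (intro summable_add summable)
  have b_nonneg: "0 \<le> b j" for j unfolding b_def using u by simp
  obtain J where "norm (\<Sum>i. b (i + J)) < 1/2"
    using suminf_exist_split[OF _ b, of "1/2"] by auto
  then have J: "(\<Sum>i. b (i + J)) < 1/2" by simp
  define I where "I = {k::int. \<bar>k\<bar> < int J}"
  have fin_I: "finite I" by (rule finite_subset[of _ "{- int J..int J}"]) (auto simp: I_def)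
  define c where "c = (\<Prod>k\<in>I. measure M (X k))"
  have c: "c > 0" unfolding c_def by (intro prod_pos) (simp add: pos)
  define H where "H n = {\<omega> \<in> space P. \<forall>k\<in>I \<union> {- int n..int n}. \<omega> k \<in> X k}" for n
  have H_sets: "H n \<in> sets P" for n
    unfolding H_def P_def using fin_I X by measurable
  have "c / 2 \<le> measure P (H n)" for n
  proof -
    define K where "K = {- int n..int n} - I"
    have fin_K: "finite K" unfolding K_def by simp
    have "sum u K \<le> (\<Sum>j<n + 1. b (j + J))"
    proof -
      have "K \<subseteq> (\<lambda>j. int (j + J)) ` {..<n + 1} \<union> (\<lambda>j. - int (j + J)) ` {..<n + 1}"
      proof
        fix k assume k: "k \<in> K"
        then have "k = int (nat \<bar>k\<bar> - J + J) \<or> k = - int (nat \<bar>k\<bar> - J + J)" "nat \<bar>k\<bar> - J < n + 1"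
          unfolding K_def I_def by auto
        then show "k \<in> (\<lambda>j. int (j + J)) ` {..<n + 1} \<union> (\<lambda>j. - int (j + J)) ` {..<n + 1}"
          by blast
      qed
      then have "sum u K \<le> sum u ((\<lambda>j. int (j + J)) ` {..<n + 1} \<union> (\<lambda>j. - int (j + J)) ` {..<n + 1})"
        using u by (intro sum_mono2) auto
      also have "\<dots> \<le> sum u ((\<lambda>j. int (j + J)) ` {..<n + 1}) + sum u ((\<lambda>j. - int (j + J)) ` {..<n + 1})"
        using u by (subst sum_Un) (auto intro!: sum_nonneg)
      also have "\<dots> = (\<Sum>j<n + 1. b (j + J))"
        unfolding b_def by (simp add: sum.reindex inj_on_def sum.distrib)
      finally show ?thesis .
    qed
    also have "\<dots> \<le> (\<Sum>j. b (j + J))"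
      using b_nonneg b by (intro sum_le_suminf) (auto simp: summable_iff_shift)
    finally have "1/2 \<le> 1 - sum u K" using J by simp
    also have "\<dots> \<le> (\<Prod>k\<in>K. 1 - u k)"
      using u by (intro Weierstrass_prod_ineq) auto
    finally have "c * (1/2) \<le> c * (\<Prod>k\<in>K. 1 - u k)"
      using c by (intro mult_left_mono) auto
    then have "c / 2 \<le> c * (\<Prod>k\<in>K. measure M (X k))"
      by (simp add: u_def)
    also have "\<dots> = (\<Prod>k\<in>I \<union> K. measure M (X k))"
      unfolding c_def using fin_I fin_K by (intro prod.union_disjoint[symmetric]) (auto simp: K_def)
    also have "I \<union> K = I \<union> {- int n..int n}" unfolding K_def by blast
    also have "(\<Prod>k\<in>\<dots>. measure M (X k)) = measure P (H n)"
      unfolding H_def P_def using fin_I X by (intro measure_cylinder[symmetric] M) auto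
    finally show ?thesis .
  qed
  moreover have "(\<lambda>n. measure P (H n)) \<longlonglongrightarrow> measure P (\<Inter>n. H n)"
    using H_sets by (intro finite_Lim_measure_decseq) (auto simp: decseq_def H_def)
  ultimately have "c / 2 \<le> measure P (\<Inter>n. H n)"
    by (intro LIMSEQ_le_const) auto
  moreover have "(\<Inter>n. H n) = {\<omega> \<in> space P. \<forall>k. \<omega> k \<in> X k}"
  proof -
    have "\<omega> k \<in> X k" if "\<omega> \<in> (\<Inter>n. H n)" for \<omega> k
    proof -
      have "\<omega> \<in> H (nat \<bar>k\<bar>)" using that by blast
      then have "\<forall>i\<in>I \<union> {- \<bar>k\<bar>..\<bar>k\<bar>}. \<omega> i \<in> X i" unfolding H_def by simp
      moreover have "k \<in> {- \<bar>k\<bar>..\<bar>k\<bar>}" by (simp add: abs_if)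
      ultimately show ?thesis by blast
    qed
    then show ?thesis unfolding H_def by auto
  qed
  ultimately show ?thesis using c unfolding P_def by simp
qed

text \<open>
  The sum takes only countably many values and depends on finitely many coordinates, so
  it is measurable without any assumption on the topology of the target.
\<close>

lemma measurable_cylinder_sum:
  fixes a :: "'i \<Rightarrow> 'b::countable \<Rightarrow> 'a::{comm_monoid_add, topological_space}"
  assumes "finite F"
  shows "(\<lambda>\<omega>. \<Sum>k\<in>F. a k (\<omega> k)) \<in> borel_measurable (PiM UNIV (\<lambda>_. measure_pmf p))"
proof -
  let ?P = "PiM (UNIV :: 'i set) (\<lambda>_. measure_pmf p)"
  have space: "space ?P = UNIV" by (simp add: space_PiM PiE_UNIV_domain)
  have coord: "{\<omega>. \<omega> k = m} \<in> sets ?P" for k m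
    using measurable_sets[OF measurable_component_singleton[of k UNIV "\<lambda>_. measure_pmf p"], of "{m}"]
    by (simp add: space vimage_def)
  have "{\<omega>. (\<Sum>k\<in>F. a k (\<omega> k)) \<in> C} \<in> sets ?P" for C
    using assms
  proof (induction F arbitrary: C)
    case empty
    then show ?case using sets.top[of ?P] unfolding space by (cases "0 \<in> C") auto
  next
    case (insert k F)
    have "{\<omega>. (\<Sum>k\<in>insert k F. a k (\<omega> k)) \<in> C} =
        (\<Union>m. {\<omega>. \<omega> k = m} \<inter> {\<omega>. (\<Sum>k\<in>F. a k (\<omega> k)) \<in> {y. a k m + y \<in> C}})"
      using insert.hyps by auto
    also have "\<dots> \<in> sets ?P"
      by (intro sets.countable_UN'' sets.Int coord insert.IH) auto
    finally show ?case .
  qed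
  then show ?thesis
    by (intro measurableI) (auto simp: space vimage_def)
qed

section \<open>A law for the random symbols\<close>

text \<open>
  The weights \<open>2\<^sup>-\<^sup>m / (N m + 1)\<close>, normalised to total mass one, give \<open>N\<close> a finite expectation, and the
  expectation of \<open>N\<close> is the sum of its tail probabilities.
\<close>

lemma pmf_with_small_level_tails:
  fixes N :: "nat \<Rightarrow> nat"
  obtains p :: "nat pmf" where "\<And>m. pmf p m > 0"
    and "summable (\<lambda>j. measure (measure_pmf p) {m. j < N m})"
proof -
  define w :: "nat \<Rightarrow> real" where "w m = (1/2) ^ m / (N m + 1)" for m
  have w_pos: "w m > 0" for m unfolding w_def by simp
  have w_le: "w m * N m \<le> (1/2) ^ m" and w_le': "w m \<le> (1/2) ^ m" for m
    unfolding w_def by (simp_all add: divide_simps)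
  have geo: "summable (\<lambda>m. (1/2 :: real) ^ m)" by (rule summable_geometric) simp
  have w_sum: "summable w"
    using w_pos w_le' by (intro summable_comparison_test'[OF geo, of 0]) (simp add: less_imp_le)
  define W where "W = suminf w"
  have W: "W > 0" unfolding W_def using w_sum w_pos by (rule suminf_pos)
  define p where "p = embed_pmf (\<lambda>m. w m / W)"
  have nn: "0 \<le> w m / W" for m using w_pos W by (simp add: less_imp_le)
  have "(\<integral>\<^sup>+m. ennreal (w m / W) \<partial>count_space UNIV) = (\<Sum>m. ennreal (w m / W))"
    by (rule nn_integral_count_space_nat)
  also have "\<dots> = ennreal (\<Sum>m. w m / W)"
    using nn summable_divide[OF w_sum] by (intro suminf_ennreal2) auto
  also have "(\<Sum>m. w m / W) = 1"
    using suminf_divide[OF w_sum, of W] W by (simp add: W_def)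
  finally have pmf: "pmf p m = w m / W" for m
    unfolding p_def using nn by (intro pmf_embed_pmf) auto
  have "(\<Sum>j. emeasure (measure_pmf p) {m. j < N m}) = (\<integral>\<^sup>+m. of_nat (N m) \<partial>measure_pmf p)"
    using nn_integral_nat_function[of N "measure_pmf p"] by simp
  also have "\<dots> = (\<Sum>m. ennreal (pmf p m * N m))"
    unfolding nn_integral_measure_pmf nn_integral_count_space_nat
    by (intro suminf_cong) (simp add: ennreal_mult ennreal_of_nat_eq_real_of_nat)
  also have "\<dots> \<le> (\<Sum>m. ennreal ((1/2) ^ m / W))"
    using w_le W by (intro suminf_le ennreal_leI) (auto simp: pmf divide_right_mono)
  also have "\<dots> = ennreal (\<Sum>m. (1/2) ^ m / W)"
    using W summable_divide[OF geo] by (intro suminf_ennreal2) auto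
  finally have "(\<Sum>j. ennreal (measure (measure_pmf p) {m. j < N m})) \<le> ennreal (\<Sum>m. (1/2) ^ m / W)"
    by (simp add: measure_pmf.emeasure_eq_measure)
  then have "(\<Sum>j. ennreal (measure (measure_pmf p) {m. j < N m})) \<noteq> \<top>"
    by (metis ennreal_less_top leD top.not_eq_extremum)
  then have "summable (\<lambda>j. measure (measure_pmf p) {m. j < N m})"
    by (intro summable_suminf_not_top) auto
  then show thesis using that[of p] pmf w_pos W by simp
qed

section \<open>Groups with a complete invariant metric\<close>

text \<open>
  An abelian topological group whose topology comes from a complete invariant metric. The metric is
  a locale parameter because it is not part of the type; facts of the type classes for metric and
  Hausdorff spaces are therefore restated below for this metric.
\<close>

locale invariant_complete_metric =
  fixes d :: "'a::topological_ab_group_add \<Rightarrow> 'a \<Rightarrow> real"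
  assumes metric: "Metric_space UNIV d"
    and topology: "Metric_space.mtopology UNIV d = euclidean"
    and complete: "Metric_space.mcomplete UNIV d"
    and invariant: "d (x + z) (y + z) = d x y"
begin

sublocale Metric_space UNIV d by (rule metric)

text \<open>The distance to \<open>0\<close>. It is subadditive and symmetric, but need not be homogeneous.\<close>

definition magnitude :: "'a \<Rightarrow> real" where "magnitude x = d 0 x"

lemma dist_eq_magnitude: "d x y = magnitude (y - x)"
  unfolding magnitude_def using invariant[of 0 x "y - x"] by simp

lemma magnitude_0 [simp]: "magnitude 0 = 0"
  by (simp add: magnitude_def)

lemma magnitude_minus: "magnitude (x - y) = magnitude (y - x)"
  using commute by (simp flip: dist_eq_magnitude)

lemma magnitude_add_le: "magnitude (x + y) \<le> magnitude x + magnitude y"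
  using triangle[of 0 x "x + y"] by (simp add: dist_eq_magnitude)

lemma magnitude_sum_le: "magnitude (sum f A) \<le> (\<Sum>i\<in>A. magnitude (f i))"
proof (induction A rule: infinite_finite_induct)
  case (insert i A)
  then show ?case using magnitude_add_le[of "f i" "sum f A"] by simp
qed simp_all

lemma open_iff_magnitude: "open U \<longleftrightarrow> (\<forall>x\<in>U. \<exists>r>0. \<forall>y. magnitude (y - x) < r \<longrightarrow> y \<in> U)"
proof -
  have "open U \<longleftrightarrow> openin mtopology U" by (simp add: topology)
  then show ?thesis
    unfolding openin_mtopology by (auto simp: subset_iff dist_eq_magnitude)
qed

lemma tendsto_iff_magnitude: "(f \<longlongrightarrow> l) F \<longleftrightarrow> (\<forall>e>0. \<forall>\<^sub>F i in F. magnitude (f i - l) < e)"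
proof -
  have "(f \<longlongrightarrow> l) F \<longleftrightarrow> limitin mtopology f l F" by (simp add: topology)
  then show ?thesis
    by (simp add: limitin_metric dist_eq_magnitude magnitude_minus[of l])
qed

lemma Cauchy_imp_convergent:
  assumes "\<And>e. e > 0 \<Longrightarrow> \<exists>N. \<forall>m\<ge>N. \<forall>n\<ge>N. magnitude (X m - X n) < e"
  shows "\<exists>l. X \<longlonglongrightarrow> l"
proof -
  have "MCauchy X"
    unfolding MCauchy_def
  proof (intro conjI allI impI)
    fix e :: real assume "e > 0"
    from assms[OF this] obtain N where N: "\<forall>m\<ge>N. \<forall>n\<ge>N. magnitude (X m - X n) < e" ..
    then show "\<exists>N. \<forall>m n. N \<le> m \<longrightarrow> N \<le> n \<longrightarrow> d (X m) (X n) < e"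
      by (intro exI[of _ N]) (simp add: dist_eq_magnitude)
  qed simp
  then have "\<exists>l. limitin mtopology X l sequentially"
    using complete unfolding mcomplete_def by blast
  then show ?thesis
    unfolding topology by simp
qed

lemma tendsto_unique_magnitude:
  fixes f :: "'b \<Rightarrow> 'a"
  assumes "(f \<longlongrightarrow> l) F" "(f \<longlongrightarrow> l') F" "F \<noteq> bot"
  shows "l = l'"
proof -
  have "limitin mtopology f l F" "limitin mtopology f l' F" using assms by (simp_all add: topology)
  then show ?thesis using assms(3) limitin_metric_unique by blast
qed

lemma has_sum_unique_magnitude:
  fixes f :: "'b \<Rightarrow> 'a"
  shows "(f has_sum l) A \<Longrightarrow> (f has_sum l') A \<Longrightarrow> l = l'"
  unfolding has_sum_def by (rule tendsto_unique_magnitude[OF _ _ finite_subsets_at_top_neq_bot])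

text \<open>
  For an open set \<open>U\<close>, let \<open>C j\<close> be the closed set of points whose ball of radius \<open>1 / (j + 1)\<close>
  lies in \<open>U\<close>. The limit of a sequence lies in \<open>U\<close> if and only if the sequence is eventually in one
  of the \<open>C j\<close>.
\<close>

lemma borel_measurable_LIMSEQ_magnitude:
  fixes X :: "nat \<Rightarrow> 'b \<Rightarrow> 'a"
  assumes X: "\<And>n. X n \<in> borel_measurable M"
    and lim: "\<And>\<omega>. \<omega> \<in> space M \<Longrightarrow> (\<lambda>n. X n \<omega>) \<longlonglongrightarrow> Y \<omega>"
  shows "Y \<in> borel_measurable M"
proof (rule borel_measurableI)
  fix U :: "'a set" assume "open U"
  define C where "C j = {x. \<forall>y. magnitude (y - x) < 1 / Suc j \<longrightarrow> y \<in> U}" for j :: nat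
  have closed: "closed (C j)" for j
    unfolding closed_def open_iff_magnitude
  proof
    fix x assume "x \<in> - C j"
    then obtain y where y: "magnitude (y - x) < 1 / Suc j" "y \<notin> U" unfolding C_def by auto
    have "x' \<in> - C j" if "magnitude (x' - x) < 1 / Suc j - magnitude (y - x)" for x'
      using magnitude_add_le[of "y - x" "x - x'"] that y magnitude_minus[of x x'] unfolding C_def by fastforce
    then show "\<exists>r>0. \<forall>x'. magnitude (x' - x) < r \<longrightarrow> x' \<in> - C j"
      using y(1) by (intro exI[of _ "1 / Suc j - magnitude (y - x)"]) auto
  qed
  have "Y \<omega> \<in> U \<longleftrightarrow> (\<exists>j. eventually (\<lambda>n. X n \<omega> \<in> C j) sequentially)" if \<omega>: "\<omega> \<in> space M" for \<omega>
  proof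
    assume "Y \<omega> \<in> U"
    then obtain r where r: "r > 0" "\<And>y. magnitude (y - Y \<omega>) < r \<Longrightarrow> y \<in> U"
      using \<open>open U\<close> unfolding open_iff_magnitude by blast
    obtain j where j: "1 / Suc j < r / 2"
      using reals_Archimedean[of "r / 2"] r(1) by (auto simp: inverse_eq_divide)
    have "eventually (\<lambda>n. magnitude (X n \<omega> - Y \<omega>) < r / 2) sequentially"
      using lim[OF \<omega>] r(1) unfolding tendsto_iff_magnitude using half_gt_zero by blast
    then have "eventually (\<lambda>n. X n \<omega> \<in> C j) sequentially"
    proof eventually_elim
      case (elim n)
      have "y \<in> U" if "magnitude (y - X n \<omega>) < 1 / Suc j" for y
        using magnitude_add_le[of "y - X n \<omega>" "X n \<omega> - Y \<omega>"] elim that j by (intro r(2)) simp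
      then show ?case unfolding C_def by blast
    qed
    then show "\<exists>j. eventually (\<lambda>n. X n \<omega> \<in> C j) sequentially" ..
  next
    assume "\<exists>j. eventually (\<lambda>n. X n \<omega> \<in> C j) sequentially"
    then obtain j where j: "eventually (\<lambda>n. X n \<omega> \<in> C j) sequentially" ..
    have "eventually (\<lambda>n. magnitude (X n \<omega> - Y \<omega>) < 1 / Suc j) sequentially"
      using lim[OF \<omega>] unfolding tendsto_iff_magnitude by simp
    with j have "eventually (\<lambda>n. Y \<omega> \<in> U) sequentially"
      by eventually_elim (simp add: C_def magnitude_minus)
    then show "Y \<omega> \<in> U" by simp
  qed
  then have "Y -` U \<inter> space M = {\<omega> \<in> space M. \<exists>j N. \<forall>n\<ge>N. X n \<omega> \<in> C j}"
    by (auto simp: eventually_sequentially)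
  also have "\<dots> \<in> sets M"
    using X borel_closed[OF closed] by measurable
  finally show "Y -` U \<inter> space M \<in> sets M" .
qed

lemma summable_on_Cauchy:
  fixes f :: "int \<Rightarrow> 'a"
  assumes tail: "\<And>e. e > 0 \<Longrightarrow> \<exists>J::nat. \<forall>F. finite F \<and> (\<forall>k\<in>F. int J \<le> \<bar>k\<bar>) \<longrightarrow> magnitude (sum f F) < e"
  shows "f summable_on UNIV"
proof -
  define X where "X n = sum f {- int n<..<int n}" for n
  have X_diff: "magnitude (X m - X n) < e"
    if "\<forall>F. finite F \<and> (\<forall>k\<in>F. int J \<le> \<bar>k\<bar>) \<longrightarrow> magnitude (sum f F) < e" "J \<le> n" "n \<le> m" for J e m n
  proof -
    have "X m - X n = sum f ({- int m<..<int m} - {- int n<..<int n})"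
      unfolding X_def using that(3) by (subst sum_diff) auto
    moreover have "int J \<le> \<bar>k\<bar>" if "k \<in> {- int m<..<int m} - {- int n<..<int n}" for k
      using that \<open>J \<le> n\<close> by auto
    ultimately show ?thesis using that(1) by simp
  qed
  have "\<exists>l. X \<longlonglongrightarrow> l"
  proof (rule Cauchy_imp_convergent)
    fix e :: real assume "e > 0"
    from tail[OF this] obtain J :: nat
      where J: "\<forall>F. finite F \<and> (\<forall>k\<in>F. int J \<le> \<bar>k\<bar>) \<longrightarrow> magnitude (sum f F) < e" by blast
    have "magnitude (X m - X n) < e" if "J \<le> m" "J \<le> n" for m n
    proof (cases "n \<le> m")
      case True
      then show ?thesis using X_diff[OF J] that by blast
    next
      case False
      then have "magnitude (X n - X m) < e" using X_diff[OF J] that by simp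
      then show ?thesis by (simp only: magnitude_minus[of "X m"])
    qed
    then show "\<exists>N. \<forall>m\<ge>N. \<forall>n\<ge>N. magnitude (X m - X n) < e" by blast
  qed
  then obtain l where l: "X \<longlonglongrightarrow> l" ..
  have "(f has_sum l) UNIV"
    unfolding has_sum_def tendsto_iff_magnitude eventually_finite_subsets_at_top
  proof (intro allI impI)
    fix e :: real assume e: "e > 0"
    with tail[of "e / 2"] obtain J :: nat
      where J: "\<And>F. finite F \<Longrightarrow> (\<forall>k\<in>F. int J \<le> \<bar>k\<bar>) \<Longrightarrow> magnitude (sum f F) < e / 2" by auto
    have "eventually (\<lambda>n. magnitude (X n - l) < e / 2) sequentially"
      using l e unfolding tendsto_iff_magnitude using half_gt_zero by blast
    then have "eventually (\<lambda>n. n \<ge> J \<and> magnitude (X n - l) < e / 2) sequentially"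
      by (intro eventually_conj eventually_ge_at_top)
    then obtain n where n: "n \<ge> J" "magnitude (X n - l) < e / 2"
      using eventually_happens'[OF sequentially_bot] by blast
    have "magnitude (sum f F - l) < e" if F: "finite F" "{- int n<..<int n} \<subseteq> F" for F
    proof -
      have eq: "sum f F - l = sum f (F - {- int n<..<int n}) + (X n - l)"
        unfolding X_def using F by (subst sum_diff) auto
      moreover have "magnitude (sum f (F - {- int n<..<int n})) < e / 2"
        using n(1) F(1) by (intro J) auto
      ultimately show ?thesis
        using magnitude_add_le[of "sum f (F - {- int n<..<int n})" "X n - l"] n(2)
        unfolding eq by linarith
    qed
    then show "\<exists>K. finite K \<and> K \<subseteq> UNIV \<and>
        (\<forall>F. finite F \<and> K \<subseteq> F \<and> F \<subseteq> UNIV \<longrightarrow> magnitude (sum f F - l) < e)"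
      by (intro exI[of _ "{- int n<..<int n}"]) auto
  qed
  then show ?thesis unfolding summable_on_def ..
qed

lemma has_sum_int_LIMSEQ:
  fixes f :: "int \<Rightarrow> 'a"
  assumes "(f has_sum l) UNIV"
  shows "(\<lambda>n. sum f {- int n<..<int n}) \<longlonglongrightarrow> l"
proof -
  have "filterlim (\<lambda>n. {- int n<..<int n}) (finite_subsets_at_top UNIV) sequentially"
    unfolding filterlim_finite_subsets_at_top
  proof (intro allI impI)
    fix K :: "int set" assume K: "finite K \<and> K \<subseteq> UNIV"
    then obtain c where c: "\<And>k. k \<in> K \<Longrightarrow> \<bar>k\<bar> \<le> c"
      by (meson finite_imageI Max_ge imageI)
    show "\<forall>\<^sub>F n in sequentially. finite {- int n<..<int n} \<and>
        K \<subseteq> {- int n<..<int n} \<and> {- int n<..<int n} \<subseteq> UNIV"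
      using eventually_gt_at_top[of "nat c"] 
    proof eventually_elim
      case (elim n)
      then show ?case using c by force
    qed
  qed
  then show ?thesis
    using filterlim_compose[OF assms[unfolded has_sum_def]] by blast
qed

lemma has_sum_magnitude_le:
  assumes sum: "(f has_sum l) UNIV" and K: "finite K"
    and le: "\<And>F. finite F \<Longrightarrow> F \<inter> K = {} \<Longrightarrow> magnitude (sum f F) \<le> e"
  shows "magnitude (l - sum f K) \<le> e"
proof (rule field_le_epsilon)
  fix r :: real assume "r > 0"
  then have "\<forall>\<^sub>F F in finite_subsets_at_top UNIV. magnitude (sum f F - l) < r"
    using sum unfolding has_sum_def tendsto_iff_magnitude by simp
  then obtain X where X: "finite X" "\<And>F. finite F \<Longrightarrow> X \<subseteq> F \<Longrightarrow> magnitude (sum f F - l) < r"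
    unfolding eventually_finite_subsets_at_top by auto
  have eq: "l - sum f K = (l - sum f (X \<union> K)) + sum f (X - K)"
  proof -
    have "(X - K) \<union> K = X \<union> K" by blast
    then show ?thesis using X(1) K sum.union_disjoint[of "X - K" K f] by (auto simp: algebra_simps)
  qed
  moreover have "magnitude (sum f (X - K)) \<le> e" using X(1) by (intro le) auto
  moreover have near: "magnitude (sum f (X \<union> K) - l) < r" using X(1) K by (intro X(2)) auto
  ultimately show "magnitude (l - sum f K) \<le> e + r"
    using magnitude_add_le[of "l - sum f (X \<union> K)" "sum f (X - K)"]
      magnitude_minus[of l "sum f (X \<union> K)"] near unfolding eq by linarith
qed

lemma open_magnitude_ball: "e > 0 \<Longrightarrow> open {y. magnitude y < e}"
  unfolding open_iff_magnitude
proof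
  fix x assume "x \<in> {y. magnitude y < e}"
  then show "\<exists>r>0. \<forall>y. magnitude (y - x) < r \<longrightarrow> y \<in> {y. magnitude y < e}"
  proof (intro exI[of _ "e - magnitude x"] conjI allI impI)
    fix y assume "magnitude (y - x) < e - magnitude x"
    then show "y \<in> {y. magnitude y < e}" using magnitude_add_le[of "y - x" x] by simp
  qed simp
qed

text \<open>
  A separable metric space has a countable dense subset inside any given dense set: approximate
  each point of a countable dense set by points of \<open>X\<close>, with error \<open>1 / (j + 1)\<close> for every \<open>j\<close>.
\<close>

lemma countable_dense_sequence:
  assumes "separable_space (euclidean :: 'a topology)" and X: "closure X = UNIV"
  shows "\<exists>x :: nat \<Rightarrow> 'a. (\<forall>m. x m \<in> X) \<and> (\<forall>U. open U \<longrightarrow> U \<noteq> {} \<longrightarrow> (\<exists>m. x m \<in> U))"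
proof -
  obtain D :: "'a set" where D: "countable D" "euclidean closure_of D = UNIV"
    using assms(1) unfolding separable_space_def by auto
  have "D \<noteq> {}" using D(2) by auto
  have dense: "\<exists>y\<in>Y. magnitude (y - x) < r" if "euclidean closure_of Y = UNIV" "r > 0" for Y x r
  proof -
    have "x \<in> mtopology closure_of Y" using that(1) by (simp add: topology)
    then show ?thesis
      using that(2) unfolding metric_closure_of by (auto simp: dist_eq_magnitude)
  qed
  have "\<exists>y\<in>X. magnitude (y - from_nat_into D i) < 1 / Suc j" for i j :: nat
    using X by (intro dense) (auto simp: euclidean_closure_of)
  then obtain y :: "nat \<Rightarrow> nat \<Rightarrow> 'a" where
    y: "\<And>i j. y i j \<in> X" "\<And>i j. magnitude (y i j - from_nat_into D i) < 1 / Suc j"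
    by metis
  have "\<exists>i j. y i j \<in> U" if U: "open U" "U \<noteq> {}" for U
  proof -
    obtain u where "u \<in> U" using U(2) by blast
    then obtain r where r: "r > 0" "\<And>v. magnitude (v - u) < r \<Longrightarrow> v \<in> U"
      using U(1) unfolding open_iff_magnitude by blast
    obtain v where v: "v \<in> D" "magnitude (v - u) < r / 2"
      using dense[OF D(2), of "r / 2" u] r(1) by auto
    obtain i where i: "from_nat_into D i = v"
      using from_nat_into_surj[OF D(1) v(1)] by blast
    obtain j where j: "1 / Suc j < r / 2"
      using reals_Archimedean[of "r / 2"] r(1) by (auto simp: inverse_eq_divide)
    have "magnitude (y i j - u) < r"
      using magnitude_add_le[of "y i j - v" "v - u"] y(2)[of i j] v(2) j unfolding i by simp
    then show ?thesis using r(2) by blast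
  qed
  then have "\<exists>m. case_prod y (prod_decode m) \<in> U" if "open U" "U \<noteq> {}" for U
    using that by (metis case_prod_conv prod_encode_inverse)
  moreover have "case_prod y (prod_decode m) \<in> X" for m
    using y(1) by (simp add: case_prod_beta)
  ultimately show ?thesis by (intro exI[of _ "\<lambda>m. case_prod y (prod_decode m)"]) blast
qed

text \<open>
  The key estimate: if each series \<open>\<Sum>k. a k m\<close> has small tails, then so have the mixed series
  \<open>\<Sum>k. a k (c k)\<close>, uniformly in all \<open>c\<close> that use the symbol \<open>m\<close> only at places beyond \<open>N m\<close>.
\<close>

lemma mixed_series_tail:
  fixes a :: "int \<Rightarrow> nat \<Rightarrow> 'a" and N :: "nat \<Rightarrow> nat"
  assumes tail: "\<And>m e. e > 0 \<Longrightarrow>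
      \<exists>J::nat. \<forall>F. finite F \<and> (\<forall>k\<in>F. int J \<le> \<bar>k\<bar>) \<longrightarrow> magnitude (\<Sum>k\<in>F. a k m) < e"
    and N: "\<And>m F. finite F \<Longrightarrow> (\<forall>k\<in>F. int (N m) \<le> \<bar>k\<bar>) \<Longrightarrow> magnitude (\<Sum>k\<in>F. a k m) \<le> (1/4) ^ m"
    and e: "e > 0"
  shows "\<exists>J::nat. \<forall>c F. finite F \<and> (\<forall>k\<in>F. int J \<le> \<bar>k\<bar> \<and> int (N (c k)) \<le> \<bar>k\<bar>) \<longrightarrow>
      magnitude (\<Sum>k\<in>F. a k (c k)) < e"
proof -
  \<comment> \<open>The terms with symbol \<open>m\<close> shall contribute at most \<open>e / 4 * 2\<^sup>-\<^sup>m\<close>. For \<open>m > M\<close> the level bound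
      \<open>4\<^sup>-\<^sup>m\<close> suffices; the finitely many \<open>m \<le> M\<close> are handled by going far enough out.\<close>
  obtain M where M: "(1/2) ^ M < e / 4"
    using real_arch_pow_inv[of "e / 4" "1/2"] e by auto
  have "\<exists>J::nat. \<forall>F. finite F \<and> (\<forall>k\<in>F. int J \<le> \<bar>k\<bar>) \<longrightarrow> magnitude (\<Sum>k\<in>F. a k m) < e / 4 * (1/2) ^ m" for m
    using e by (intro tail) simp
  then obtain J :: "nat \<Rightarrow> nat" where
    J: "\<And>m F. finite F \<Longrightarrow> (\<forall>k\<in>F. int (J m) \<le> \<bar>k\<bar>) \<Longrightarrow> magnitude (\<Sum>k\<in>F. a k m) < e / 4 * (1/2) ^ m"
    by metis
  define J0 where "J0 = Max (J ` {..M})"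
  have J0: "J m \<le> J0" if "m \<le> M" for m
    unfolding J0_def using that by (intro Max_ge) auto
  have "magnitude (\<Sum>k\<in>F. a k (c k)) < e"
    if F: "finite F" "\<And>k. k \<in> F \<Longrightarrow> int J0 \<le> \<bar>k\<bar>" "\<And>k. k \<in> F \<Longrightarrow> int (N (c k)) \<le> \<bar>k\<bar>" for c F
  proof -
    have group: "magnitude (\<Sum>k\<in>{k\<in>F. c k = m}. a k (c k)) \<le> e / 4 * (1/2) ^ m" for m
    proof -
      have eq: "(\<Sum>k\<in>{k\<in>F. c k = m}. a k (c k)) = (\<Sum>k\<in>{k\<in>F. c k = m}. a k m)"
        by (intro sum.cong) auto
      show ?thesis
      proof (cases "m \<le> M")
        case True
        then show ?thesis
          unfolding eq using F(1,2) J0[OF True] by (intro less_imp_le J) fastforce+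
      next
        case False
        then have "(1/2) ^ m \<le> (1/2 :: real) ^ M" by (intro power_decreasing) auto
        with M have "(1/2) ^ m \<le> e / 4" by (rule order_trans[OF _ less_imp_le, rotated])
        then have "(1/2) ^ m * (1/2) ^ m \<le> e / 4 * (1/2) ^ m"
          by (rule mult_right_mono) simp
        moreover have "(1/4 :: real) ^ m = (1/2) ^ m * (1/2) ^ m"
          by (simp flip: power_mult_distrib)
        moreover have "magnitude (\<Sum>k\<in>{k\<in>F. c k = m}. a k m) \<le> (1/4) ^ m"
          using F(1,3) by (intro N) auto
        ultimately show ?thesis unfolding eq by linarith
      qed
    qed
    have "(\<Sum>k\<in>F. a k (c k)) = (\<Sum>m\<in>c ` F. \<Sum>k\<in>{k\<in>F. c k = m}. a k (c k))"
      using F(1) by (rule sum.image_gen)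
    also have "magnitude \<dots> \<le> (\<Sum>m\<in>c ` F. e / 4 * (1/2) ^ m)"
      by (rule order_trans[OF magnitude_sum_le]) (intro sum_mono group)
    also have "\<dots> = e / 4 * (\<Sum>m\<in>c ` F. (1/2) ^ m)"
      by (simp add: sum_distrib_left)
    also have "(\<Sum>m\<in>c ` F. (1/2) ^ m) \<le> (\<Sum>m. (1/2 :: real) ^ m)"
      using F(1) by (intro sum_le_suminf summable_geometric) auto
    also have "(\<Sum>m. (1/2 :: real) ^ m) = 2"
      by (subst suminf_geometric) auto
    finally show ?thesis using e by simp
  qed
  then show ?thesis by blast
qed

end

section \<open>The random series of orbits\<close>

text \<open>
  The data of the random series: full orbits \<open>k \<mapsto> a k m\<close> of an additive continuous map \<open>T\<close>, with
  the zero orbit as the orbit of the symbol \<open>0\<close>; levels \<open>N m\<close> beyond which the orbit of \<open>m\<close>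
  contributes at most \<open>4\<^sup>-\<^sup>m\<close>; and a law \<open>p\<close> of the symbols under which high levels are rare.
\<close>

locale random_orbit_series = invariant_complete_metric d
  for d :: "'a::topological_ab_group_add \<Rightarrow> 'a \<Rightarrow> real" +
  fixes T :: "'a \<Rightarrow> 'a" and a :: "int \<Rightarrow> nat \<Rightarrow> 'a" and N :: "nat \<Rightarrow> nat" and p :: "nat pmf"
  assumes T_add: "T (x + y) = T x + T y"
    and T_cont: "continuous_on UNIV T"
    and orbit: "T (a k m) = a (k + 1) m"
    and zero: "a k 0 = 0"
    and dense: "open U \<Longrightarrow> U \<noteq> {} \<Longrightarrow> \<exists>m. a 0 m \<in> U"
    and tail: "e > 0 \<Longrightarrow> \<exists>J::nat. \<forall>F. finite F \<and> (\<forall>k\<in>F. int J \<le> \<bar>k\<bar>) \<longrightarrow>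
        magnitude (\<Sum>k\<in>F. a k m) < e"
    and N: "finite F \<Longrightarrow> (\<forall>k\<in>F. int (N m) \<le> \<bar>k\<bar>) \<Longrightarrow> magnitude (\<Sum>k\<in>F. a k m) \<le> (1/4) ^ m"
    and p_pos: "pmf p m > 0"
    and p_tail: "summable (\<lambda>j. measure (measure_pmf p) {m. j < N m})"
begin

abbreviation symbols :: "(int \<Rightarrow> nat) measure" where
  "symbols \<equiv> PiM UNIV (\<lambda>_. measure_pmf p)"

sublocale symbols: prob_space symbols
  by (rule prob_space_PiM) (rule prob_space_measure_pmf)

lemma space_symbols [simp]: "space symbols = UNIV"
  by (simp add: space_PiM PiE_UNIV_domain)

text \<open>
  The configurations in which, apart from finitely many places, every symbol \<open>m\<close> occurs only at
  places beyond its level \<open>N m\<close>.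
\<close>

definition good :: "(int \<Rightarrow> nat) set" where
  "good = {\<omega>. \<exists>J::nat. \<forall>k. int J \<le> \<bar>k\<bar> \<longrightarrow> int (N (\<omega> k)) \<le> \<bar>k\<bar>}"

text \<open>
  The sum of the random series, with the arbitrary value \<open>0\<close> on the null set outside \<open>good\<close>.
  The type is not known to be Hausdorff, so \<open>infsum\<close> is not applicable and the limit is chosen.
\<close>

definition series :: "(int \<Rightarrow> nat) \<Rightarrow> 'a" where
  "series \<omega> = (if \<omega> \<in> good then SOME l. ((\<lambda>k. a k (\<omega> k)) has_sum l) UNIV else 0)"

lemma late_symbols_small:
  assumes "e > 0"
  obtains J :: nat where "\<And>\<omega> F. finite F \<Longrightarrow> \<forall>k\<in>F. int J \<le> \<bar>k\<bar> \<and> int (N (\<omega> k)) \<le> \<bar>k\<bar> \<Longrightarrow>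
    magnitude (\<Sum>k\<in>F. a k (\<omega> k)) < e"
proof -
  from mixed_series_tail[of a N, OF tail N assms] obtain J :: nat where
    "\<forall>\<omega> F. finite F \<and> (\<forall>k\<in>F. int J \<le> \<bar>k\<bar> \<and> int (N (\<omega> k)) \<le> \<bar>k\<bar>) \<longrightarrow>
      magnitude (\<Sum>k\<in>F. a k (\<omega> k)) < e" ..
  then show thesis by (intro that[of J]) simp
qed

lemma has_sum_series:
  assumes "\<omega> \<in> good"
  shows "((\<lambda>k. a k (\<omega> k)) has_sum series \<omega>) UNIV"
proof -
  obtain J0 :: nat where J0: "\<And>k. int J0 \<le> \<bar>k\<bar> \<Longrightarrow> int (N (\<omega> k)) \<le> \<bar>k\<bar>"
    using assms unfolding good_def by blast
  have "(\<lambda>k. a k (\<omega> k)) summable_on UNIV"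
  proof (rule summable_on_Cauchy)
    fix e :: real assume "e > 0"
    then obtain J :: nat where J: "\<And>\<omega> F. finite F \<Longrightarrow>
        \<forall>k\<in>F. int J \<le> \<bar>k\<bar> \<and> int (N (\<omega> k)) \<le> \<bar>k\<bar> \<Longrightarrow> magnitude (\<Sum>k\<in>F. a k (\<omega> k)) < e"
      using late_symbols_small by blast
    show "\<exists>J::nat. \<forall>F. finite F \<and> (\<forall>k\<in>F. int J \<le> \<bar>k\<bar>) \<longrightarrow> magnitude (\<Sum>k\<in>F. a k (\<omega> k)) < e"
      using J0 by (intro exI[of _ "max J J0"] allI impI J) auto
  qed
  then have "\<exists>l. ((\<lambda>k. a k (\<omega> k)) has_sum l) UNIV"
    unfolding summable_on_def .
  from someI_ex[OF this] show ?thesis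
    unfolding series_def using assms by (simp only: if_True)
qed

lemma measurable_symbol: "(\<lambda>\<omega>. \<omega> k) \<in> symbols \<rightarrow>\<^sub>M count_space UNIV"
  using measurable_component_singleton[of k UNIV "\<lambda>_. measure_pmf p"] by simp

lemma good_sets: "good \<in> sets symbols"
proof -
  have [measurable]: "Measurable.pred symbols (\<lambda>\<omega>. int (N (\<omega> k)) \<le> \<bar>k\<bar>)" for k
    by (rule measurable_compose[OF measurable_symbol]) simp
  have "{\<omega> \<in> space symbols. \<exists>J::nat. \<forall>k. int J \<le> \<bar>k\<bar> \<longrightarrow> int (N (\<omega> k)) \<le> \<bar>k\<bar>} \<in> sets symbols"
    by measurable
  then show ?thesis by (simp add: good_def)
qed

lemma measurable_series: "series \<in> borel_measurable symbols"
proof (rule borel_measurable_LIMSEQ_magnitude)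
  show "(\<lambda>\<omega>. if \<omega> \<in> good then \<Sum>k\<in>{- int n<..<int n}. a k (\<omega> k) else 0) \<in> borel_measurable symbols" for n
    using good_sets by (intro measurable_If_set measurable_cylinder_sum) auto
  show "(\<lambda>n. if \<omega> \<in> good then \<Sum>k\<in>{- int n<..<int n}. a k (\<omega> k) else 0) \<longlonglongrightarrow> series \<omega>" for \<omega>
  proof (cases "\<omega> \<in> good")
    case True
    then show ?thesis using has_sum_int_LIMSEQ[OF has_sum_series[OF True]] by simp
  next
    case False
    then show ?thesis by (simp add: series_def)
  qed
qed

lemma measure_symbol: "measure symbols {\<omega>. \<omega> k \<in> A} = measure (measure_pmf p) A"
  using measure_cylinder[OF prob_space_measure_pmf, of "{k}" "\<lambda>_. A" p] by simp

text \<open>Borel--Cantelli, applied to both ends of the sequence at once.\<close>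

lemma AE_good: "AE \<omega> in symbols. \<omega> \<in> good"
proof -
  define bad where "bad j = {\<omega>. \<omega> (int j) \<in> {m. j < N m}} \<union> {\<omega>. \<omega> (- int j) \<in> {m. j < N m}}" for j
  have sets: "{\<omega>. \<omega> k \<in> A} \<in> sets symbols" for k A
    using measurable_sets[OF measurable_symbol, of A k] by (simp add: vimage_def)
  have bad: "bad j \<in> sets symbols" for j
    unfolding bad_def by (intro sets.Un sets)
  have le: "measure symbols (bad j) \<le> 2 * measure (measure_pmf p) {m. j < N m}" for j
    unfolding bad_def using measure_Un_le[OF sets sets, of "int j" "{m. j < N m}" "- int j" "{m. j < N m}"]
    unfolding measure_symbol by simp
  have "summable (\<lambda>j. measure symbols (bad j))"
    using le by (intro summable_comparison_test'[OF summable_mult[OF p_tail], of 0 _ 2]) simp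
  then have "AE \<omega> in symbols. eventually (\<lambda>j. \<omega> \<in> space symbols - bad j) sequentially"
    using bad by (intro borel_cantelli_AE1) (auto simp: symbols.emeasure_eq_measure)
  then show ?thesis
  proof eventually_elim
    case (elim \<omega>)
    then obtain J where J: "\<And>j. j \<ge> J \<Longrightarrow> \<omega> \<notin> bad j" unfolding eventually_sequentially by auto
    have "int (N (\<omega> k)) \<le> \<bar>k\<bar>" if "int J \<le> \<bar>k\<bar>" for k
    proof -
      have "J \<le> nat \<bar>k\<bar>" using that by linarith
      then have "\<not> nat \<bar>k\<bar> < N (\<omega> (int (nat \<bar>k\<bar>)))" "\<not> nat \<bar>k\<bar> < N (\<omega> (- int (nat \<bar>k\<bar>)))"
        using J[of "nat \<bar>k\<bar>"] unfolding bad_def by blast+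
      then show ?thesis by (cases "k \<ge> 0") auto
    qed
    then show ?case unfolding good_def by blast
  qed
qed

lemma funpow_add: "(T ^^ n) (x + y) = (T ^^ n) x + (T ^^ n) y"
  by (induction n) (simp_all add: T_add)

lemma funpow_continuous: "continuous_on UNIV (T ^^ n)"
proof (induction n)
  case (Suc n)
  then show ?case
    using continuous_on_compose2[OF T_cont Suc] by (simp add: o_def)
qed (simp add: id_def)

lemma funpow_orbit: "(T ^^ n) (a k m) = a (k + int n) m"
  by (induction n) (simp_all add: orbit add.commute add.left_commute)

text \<open>
  The set \<open>good\<close> is not invariant under the shift, because a symbol may cross its level; hence the
  two assumptions. Both hold almost surely.
\<close>

lemma series_shift:
  assumes "\<omega> \<in> good" "bilateral_shift n \<omega> \<in> good"
  shows "series (bilateral_shift n \<omega>) = (T ^^ n) (series \<omega>)"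
proof -
  have additive: "Modules.additive (T ^^ n)" by (rule Modules.additive.intro) (rule funpow_add)
  have cont: "(T ^^ n) \<midarrow>series \<omega>\<rightarrow> (T ^^ n) (series \<omega>)"
    using funpow_continuous[of n] by (simp add: continuous_on_def)
  have "((T ^^ n) \<circ> (\<lambda>k. a k (\<omega> k)) has_sum (T ^^ n) (series \<omega>)) UNIV"
    by (rule has_sum_comm_additive[OF additive cont has_sum_series[OF assms(1)]])
  moreover have "bij_betw (\<lambda>k. k - int n) UNIV UNIV"
    by (rule bij_betw_byWitness[where f' = "\<lambda>k. k + int n"]) auto
  ultimately have "((\<lambda>k. ((T ^^ n) \<circ> (\<lambda>k. a k (\<omega> k))) (k - int n)) has_sum (T ^^ n) (series \<omega>)) UNIV"
    by (subst has_sum_reindex_bij_betw)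
  then have "((\<lambda>k. a k (bilateral_shift n \<omega> k)) has_sum (T ^^ n) (series \<omega>)) UNIV"
    by (simp add: funpow_orbit bilateral_shift_def)
  then show ?thesis
    using has_sum_unique_magnitude has_sum_series[OF assms(2)] by blast
qed

lemma AE_series_shift: "AE \<omega> in symbols. series (bilateral_shift n \<omega>) = (T ^^ n) (series \<omega>)"
proof -
  have "AE \<omega> in symbols. bilateral_shift n \<omega> \<in> good"
    by (rule AE_distrD[OF measurable_bilateral_shift[of n "measure_pmf p"]])
      (simp only: distr_bilateral_shift[OF prob_space_measure_pmf] AE_good)
  with AE_good show ?thesis
    by eventually_elim (rule series_shift)
qed

text \<open>The law of the random series, a Borel measure on the group.\<close>

definition law :: "'a measure" where "law = distr symbols borel series"

lemma measure_law: "A \<in> sets borel \<Longrightarrow> measure law A = measure symbols (series -` A)"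
  unfolding law_def using measurable_series by (simp add: measure_distr)

lemma series_vimage_sets: "A \<in> sets borel \<Longrightarrow> series -` A \<in> sets symbols"
  using measurable_sets[OF measurable_series, of A] by simp

lemma funpow_vimage_sets: "A \<in> sets borel \<Longrightarrow> (T ^^ n) -` A \<in> sets borel"
  using measurable_sets[OF borel_measurable_continuous_onI[OF funpow_continuous], of A n] by simp

lemma shift_vimage_sets: "A \<in> sets symbols \<Longrightarrow> bilateral_shift n -` A \<in> sets symbols"
  using measurable_sets[OF measurable_bilateral_shift, of A "measure_pmf p" n] by simp

lemma measure_law_Int_funpow:
  assumes A: "A \<in> sets borel" and B: "B \<in> sets borel"
  shows "measure law (A \<inter> (T ^^ n) -` B) =
    measure symbols (series -` A \<inter> bilateral_shift n -` (series -` B))"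
proof -
  have "measure law (A \<inter> (T ^^ n) -` B) = measure symbols (series -` (A \<inter> (T ^^ n) -` B))"
    by (intro measure_law sets.Int A funpow_vimage_sets B)
  also have "\<dots> = measure symbols (series -` A \<inter> bilateral_shift n -` (series -` B))"
  proof (rule symbols.finite_measure_eq_AE)
    show "AE \<omega> in symbols. \<omega> \<in> series -` (A \<inter> (T ^^ n) -` B) \<longleftrightarrow>
        \<omega> \<in> series -` A \<inter> bilateral_shift n -` (series -` B)"
      using AE_series_shift[of n] by eventually_elim simp
    show "series -` (A \<inter> (T ^^ n) -` B) \<in> sets symbols"
      by (intro series_vimage_sets sets.Int A funpow_vimage_sets B)
    show "series -` A \<inter> bilateral_shift n -` (series -` B) \<in> sets symbols"
      by (intro sets.Int shift_vimage_sets series_vimage_sets A B)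
  qed
  finally show ?thesis .
qed

lemma borel_probability_law: "borel_probability law"
  unfolding borel_probability_def law_def
  using symbols.prob_space_distr[OF measurable_series] by simp

lemma strongly_mixing_law: "strongly_mixing T law"
  unfolding strongly_mixing_def
proof (intro ballI)
  fix A B :: "'a set" assume A: "A \<in> sets borel" and B: "B \<in> sets borel"
  show "(\<lambda>n. measure law (A \<inter> (T ^^ n) -` B)) \<longlonglongrightarrow> measure law A * measure law B"
    unfolding measure_law_Int_funpow[OF A B] measure_law[OF A] measure_law[OF B]
    using bernoulli_shift_mixing[OF prob_space_measure_pmf series_vimage_sets[OF A] series_vimage_sets[OF B]]
    by (simp only: space_symbols Int_UNIV_right)
qed

lemma invariant_measure_law: "invariant_measure T law"
  unfolding invariant_measure_def
proof
  fix A :: "'a set" assume A: "A \<in> sets borel"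
  have "measure law (T -` A) = measure symbols (bilateral_shift 1 -` (series -` A))"
    using measure_law_Int_funpow[of UNIV A 1] A by simp
  also have "\<dots> = measure symbols (series -` A)"
    using measure_distr[OF measurable_bilateral_shift series_vimage_sets[OF A], of 1]
      distr_bilateral_shift[OF prob_space_measure_pmf, of p 1] by simp
  finally show "measure law (T -` A) = measure law A"
    by (simp add: measure_law A)
qed

text \<open>
  On the event \<open>\<forall>k. \<omega> k \<in> X k\<close> of the proof only the place \<open>0\<close> and the places beyond \<open>J\<close>
  contribute to the series, and the latter contribute less than the radius of the given ball.
\<close>

lemma full_support_law: "full_support law"
  unfolding full_support_def
proof (intro allI impI)
  fix U :: "'a set" assume U: "open U \<and> U \<noteq> {}"
  then obtain m where m: "a 0 m \<in> U" using dense by blast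
  then obtain r where r: "r > 0" "\<And>y. magnitude (y - a 0 m) < r \<Longrightarrow> y \<in> U"
    using U unfolding open_iff_magnitude by blast
  have "r / 2 > 0" using r(1) by simp
  then obtain J0 :: nat where J0: "\<And>\<omega> F. finite F \<Longrightarrow>
      \<forall>k\<in>F. int J0 \<le> \<bar>k\<bar> \<and> int (N (\<omega> k)) \<le> \<bar>k\<bar> \<Longrightarrow> magnitude (\<Sum>k\<in>F. a k (\<omega> k)) < r / 2"
    using late_symbols_small by blast
  \<comment> \<open>\<open>J \<ge> 1\<close> makes the place \<open>0\<close> an inner one; \<open>J \<ge> N 0\<close> makes the symbol \<open>0\<close> admissible at every
      other place, so that no constraint has probability zero.\<close>
  define J where "J = Suc (max J0 (N 0))"
  define X where "X k = (if k = 0 then {m} else if \<bar>k\<bar> < int J then {0} else {i. int (N i) \<le> \<bar>k\<bar>})" for k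
  have late: "X k = {i. int (N i) \<le> \<bar>k\<bar>}" if "int J \<le> \<bar>k\<bar>" for k
    using that unfolding X_def J_def by auto
  have "0 \<in> X k" if "k \<noteq> 0" for k
    using that unfolding X_def J_def by auto
  moreover have "m \<in> X 0" unfolding X_def by simp
  ultimately have "\<exists>i. i \<in> X k" for k by metis
  then have pos: "measure (measure_pmf p) (X k) > 0" for k
    using p_pos measure_pmf_posI[of _ p "X k"] by (auto simp: pmf_positive_iff)
  have compl: "1 - measure (measure_pmf p) (X k) = measure (measure_pmf p) {i. nat \<bar>k\<bar> < N i}"
    if "int J \<le> \<bar>k\<bar>" for k
  proof -
    have "- X k = {i. nat \<bar>k\<bar> < N i}" unfolding late[OF that] by auto
    then show ?thesis using measure_pmf.prob_compl[of "X k" p] by (simp add: Compl_eq_Diff_UNIV)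
  qed
  have ev1: "eventually (\<lambda>j. measure (measure_pmf p) {i. j < N i} = 1 - measure (measure_pmf p) (X (int j)))
      sequentially"
    using eventually_ge_at_top[of J] by eventually_elim (subst compl, auto)
  have ev2: "eventually (\<lambda>j. measure (measure_pmf p) {i. j < N i} = 1 - measure (measure_pmf p) (X (- int j)))
      sequentially"
    using eventually_ge_at_top[of J] by eventually_elim (subst compl, auto)
  have "summable (\<lambda>j. 1 - measure (measure_pmf p) (X (int j)))"
      "summable (\<lambda>j. 1 - measure (measure_pmf p) (X (- int j)))"
    using p_tail summable_cong[OF ev1] summable_cong[OF ev2] by blast+
  then have "0 < measure symbols {\<omega> \<in> space symbols. \<forall>k. \<omega> k \<in> X k}"
    using pos by (intro measure_bilateral_rectangle_pos prob_space_measure_pmf) auto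
  also have "\<dots> \<le> measure symbols (series -` U)"
  proof (rule symbols.finite_measure_mono)
    show "series -` U \<in> sets symbols"
      using U by (intro series_vimage_sets) auto
    show "{\<omega> \<in> space symbols. \<forall>k. \<omega> k \<in> X k} \<subseteq> series -` U"
    proof
      fix \<omega> assume "\<omega> \<in> {\<omega> \<in> space symbols. \<forall>k. \<omega> k \<in> X k}"
      then have \<omega>: "\<omega> k \<in> X k" for k by blast
      have late_\<omega>: "int (N (\<omega> k)) \<le> \<bar>k\<bar>" if "int J \<le> \<bar>k\<bar>" for k
        using \<omega>[of k] unfolding late[OF that] by simp
      then have good: "\<omega> \<in> good" unfolding good_def by blast
      let ?K = "{- int J<..<int J}"
      have "magnitude (series \<omega> - (\<Sum>k\<in>?K. a k (\<omega> k))) \<le> r / 2"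
      proof (rule has_sum_magnitude_le[OF has_sum_series[OF good]])
        fix F :: "int set" assume F: "finite F" "F \<inter> ?K = {}"
        have "int J \<le> \<bar>k\<bar>" if "k \<in> F" for k using F(2) that by (auto simp: disjoint_iff)
        then have "\<forall>k\<in>F. int J0 \<le> \<bar>k\<bar> \<and> int (N (\<omega> k)) \<le> \<bar>k\<bar>"
          using late_\<omega> unfolding J_def by fastforce
        from J0[OF F(1) this] show "magnitude (\<Sum>k\<in>F. a k (\<omega> k)) \<le> r / 2" by simp
      qed simp
      moreover have "(\<Sum>k\<in>?K. a k (\<omega> k)) = a 0 m"
      proof -
        have "a k (\<omega> k) = 0" if "k \<in> ?K - {0}" for k
        proof -
          have "k \<noteq> 0" "\<bar>k\<bar> < int J" using that by auto
          then have "\<omega> k = 0" using \<omega>[of k] unfolding X_def by simp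
          then show ?thesis by (simp add: zero)
        qed
        moreover have "\<omega> 0 = m" using \<omega>[of 0] unfolding X_def by simp
        ultimately show ?thesis
          by (subst sum.mono_neutral_right[of _ "{0}"]) (auto simp: J_def)
      qed
      ultimately have "series \<omega> \<in> U" using r by auto
      then show "\<omega> \<in> series -` U" by simp
    qed
  qed
  also have "\<dots> = measure law U" using U by (simp add: measure_law)
  finally show "measure law U > 0" .
qed

end

section \<open>Strongly mixing measures for operators\<close>

theorem theorem1:
  fixes scaleK :: "'k::real_normed_field \<Rightarrow> 'a::topological_ab_group_add \<Rightarrow> 'a"
    and T :: "'a \<Rightarrow> 'a" and X0 :: "'a set" and S :: "nat \<Rightarrow> 'a \<Rightarrow> 'a"
  assumes "F_space scaleK"
    and "separable_space (euclidean :: 'a topology)"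
    and "operator_on scaleK T"
    and "closure X0 = UNIV"
    and "\<And>x. x \<in> X0 \<Longrightarrow> unconditionally_convergent (\<lambda>n. (T ^^ n) x)"
    and "\<And>x. x \<in> X0 \<Longrightarrow> unconditionally_convergent (\<lambda>n. S n x)"
    and "\<And>x n. x \<in> X0 \<Longrightarrow> (T ^^ n) (S n x) = x"
    and "\<And>x m n. x \<in> X0 \<Longrightarrow> m < n \<Longrightarrow> (T ^^ m) (S n x) = S (n - m) x"
  shows "\<exists>\<mu> :: 'a measure. borel_probability \<mu> \<and> invariant_measure T \<mu> \<and>
           strongly_mixing T \<mu> \<and> full_support \<mu>"
proof -
  from \<open>F_space scaleK\<close> obtain d :: "'a \<Rightarrow> 'a \<Rightarrow> real" where "invariant_complete_metric d"
    unfolding F_space_def F_space_axioms_def invariant_complete_metric_def by blast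
  then interpret invariant_complete_metric d .
  have T_add: "T (x + y) = T x + T y" for x y
    using \<open>operator_on scaleK T\<close> unfolding operator_on_def
    by (simp add: Vector_Spaces.linear_iff)
  have T_cont: "continuous_on UNIV T"
    using \<open>operator_on scaleK T\<close> unfolding operator_on_def by simp
  have T_0: "T 0 = 0" using T_add[of 0 0] by simp
  obtain x :: "nat \<Rightarrow> 'a" where x_X0: "\<And>m. x m \<in> X0"
    and x_dense: "\<And>U. open U \<Longrightarrow> U \<noteq> {} \<Longrightarrow> \<exists>m. x m \<in> U"
    using countable_dense_sequence[OF assms(2,4)] by blast
  have one_sided: "\<exists>J. \<forall>F. finite F \<and> F \<subseteq> {J..} \<longrightarrow> magnitude (\<Sum>n\<in>F. f n) < e"
    if "unconditionally_convergent f" "e > 0" for f :: "nat \<Rightarrow> 'a" and e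
    using that open_magnitude_ball[OF that(2)] unfolding unconditionally_convergent_def
    by (auto simp: interior_open dest!: spec[of _ "{y. magnitude y < e}"])
  \<comment> \<open>The symbol \<open>m + 1\<close> stands for the point \<open>x m\<close>; the symbol \<open>0\<close> is reserved for the zero orbit,
      whether or not \<open>0 \<in> X0\<close>.\<close>
  define a :: "int \<Rightarrow> nat \<Rightarrow> 'a" where
    "a k m = (if m = 0 then 0 else if k \<ge> 0 then (T ^^ nat k) (x (m - 1)) else S (nat (- k)) (x (m - 1)))" for k m
  have orbit: "T (a k m) = a (k + 1) m" for k m
  proof (cases "m = 0 \<or> k \<ge> 0")
    case True
    then show ?thesis
      by (auto simp: a_def T_0 nat_add_distrib)
  next
    case False
    show ?thesis
    proof (cases "k = - 1")
      case True
      then show ?thesis using False assms(7)[OF x_X0, of 1 "m - 1"] by (simp add: a_def)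
    next
      case k: False
      then have "nat (- k) - 1 = nat (- (k + 1))" "1 < nat (- k)" using False by auto
      then show ?thesis
        using False k assms(8)[OF x_X0, of 1 "nat (- k)" "m - 1"] by (simp add: a_def)
    qed
  qed
  have tail: "\<exists>J::nat. \<forall>F. finite F \<and> (\<forall>k\<in>F. int J \<le> \<bar>k\<bar>) \<longrightarrow> magnitude (\<Sum>k\<in>F. a k m) < e"
    if "e > 0" for m e
  proof (cases m)
    case 0
    then show ?thesis using that by (simp add: a_def)
  next
    case (Suc i)
    have "e / 2 > 0" using that by simp
    from one_sided[OF assms(5)[OF x_X0] this] obtain J1 where
      J1: "\<forall>F. finite F \<and> F \<subseteq> {J1..} \<longrightarrow> magnitude (\<Sum>n\<in>F. (T ^^ n) (x i)) < e / 2" ..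
    from one_sided[OF assms(6)[OF x_X0] \<open>e / 2 > 0\<close>] obtain J2 where
      J2: "\<forall>F. finite F \<and> F \<subseteq> {J2..} \<longrightarrow> magnitude (\<Sum>n\<in>F. S n (x i)) < e / 2" ..
    have "magnitude (\<Sum>k\<in>F. a k m) < e" if F: "finite F" "\<And>k. k \<in> F \<Longrightarrow> int (max J1 J2) \<le> \<bar>k\<bar>" for F
    proof -
      let ?P = "{k\<in>F. 0 \<le> k}" and ?N = "{k\<in>F. k < 0}"
      have "(\<Sum>k\<in>?P. a k m) = (\<Sum>n\<in>nat ` ?P. (T ^^ n) (x i))"
        by (subst sum.reindex) (auto simp: inj_on_def a_def Suc intro!: sum.cong)
      also have "magnitude \<dots> < e / 2"
        using F by (intro J1[rule_format]) force
      finally have P: "magnitude (\<Sum>k\<in>?P. a k m) < e / 2" .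
      have "(\<Sum>k\<in>?N. a k m) = (\<Sum>n\<in>(\<lambda>k. nat (- k)) ` ?N. S n (x i))"
        by (subst sum.reindex) (auto simp: inj_on_def a_def Suc intro!: sum.cong)
      also have "magnitude \<dots> < e / 2"
        using F by (intro J2[rule_format]) force
      finally have N: "magnitude (\<Sum>k\<in>?N. a k m) < e / 2" .
      have "(\<Sum>k\<in>F. a k m) = (\<Sum>k\<in>?P. a k m) + (\<Sum>k\<in>?N. a k m)"
        using F(1) by (subst sum.union_disjoint[symmetric]) (auto intro!: sum.cong)
      then show ?thesis
        using magnitude_add_le[of "\<Sum>k\<in>?P. a k m" "\<Sum>k\<in>?N. a k m"] P N by simp
    qed
    then show ?thesis by blast
  qed
  have "\<exists>J::nat. \<forall>F. finite F \<and> (\<forall>k\<in>F. int J \<le> \<bar>k\<bar>) \<longrightarrow> magnitude (\<Sum>k\<in>F. a k m) < (1/4) ^ m" for m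
    by (rule tail) simp
  then obtain N :: "nat \<Rightarrow> nat" where
    N: "\<And>m F. finite F \<Longrightarrow> (\<forall>k\<in>F. int (N m) \<le> \<bar>k\<bar>) \<Longrightarrow> magnitude (\<Sum>k\<in>F. a k m) < (1/4) ^ m"
    by metis
  obtain p :: "nat pmf" where p: "\<And>m. pmf p m > 0"
    "summable (\<lambda>j. measure (measure_pmf p) {m. j < N m})"
    using pmf_with_small_level_tails by blast
  have "random_orbit_series d T a N p"
  proof (intro random_orbit_series.intro random_orbit_series_axioms.intro)
    show "\<exists>m. a 0 m \<in> U" if "open U" "U \<noteq> {}" for U
    proof -
      from x_dense[OF that] obtain m where "x m \<in> U" ..
      then show ?thesis by (intro exI[of _ "Suc m"]) (simp add: a_def)
    qed
    show "a k 0 = 0" for k by (simp add: a_def)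
    show "magnitude (\<Sum>k\<in>F. a k m) \<le> (1/4) ^ m" if "finite F" "\<forall>k\<in>F. int (N m) \<le> \<bar>k\<bar>" for F m
      by (rule less_imp_le[OF N[OF that]])
  qed (fact invariant_complete_metric_axioms T_add T_cont orbit tail p)+
  then interpret random_orbit_series d T a N p .
  show ?thesis
    using borel_probability_law invariant_measure_law strongly_mixing_law full_support_law by blast
qed

end
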